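(* If $L$ is a finite distributive lattice, then $D(L)=1$ if and only if $D(Q_L)=1$.
   Context: A point of a lattice is join-irreducible if in the Hasse diagram it has exactly one downward edge; $Q_L$ is the subposet induced by the join-irreducible points of $L$. A coloring of a poset is distinguishing if the only color-preserving automorphism is the identity; $D(P)$ is the least number of colors in a distinguishing coloring of $P$. *)

theory Defs imports Main begin

text \<open>Posets are sets \<open>A\<close> in a type of class \<^class>\<open>order\<close>, carrying the induced order.\<close>

definition poset_automorphism :: "'a::order set \<Rightarrow> ('a \<Rightarrow> 'a) \<Rightarrow> bool" where
  "poset_automorphism A f \<longleftrightarrow>
     bij_betw f A A \<and> (\<forall>x\<in>A. \<forall>y\<in>A. x \<le> y \<longleftrightarrow> f x \<le> f y)"

definition distinguishing_coloring :: "'a::order set \<Rightarrow> ('a \<Rightarrow> 'c) \<Rightarrow> bool" where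
  "distinguishing_coloring A c \<longleftrightarrow>
     (\<forall>f. poset_automorphism A f \<and> (\<forall>x\<in>A. c (f x) = c x) \<longrightarrow> (\<forall>x\<in>A. f x = x))"

text \<open>
  The palette \<open>{1..k}\<close> is required to be nonempty, so that the empty poset has
  distinguishing number 1; it arises as the poset of join-irreducibles of the
  one-element lattice. For nonempty \<open>A\<close> the condition \<open>1 \<le> k\<close> is redundant.
\<close>

definition distinguishing_number :: "'a::order set \<Rightarrow> nat" where
  "distinguishing_number A =
     (LEAST k. 1 \<le> k \<and> (\<exists>c. c ` A \<subseteq> {1..k} \<and> distinguishing_coloring A c))"

text \<open>The minimum is attained on finite posets.\<close>

lemma distinguishing_number_witness:
  fixes A :: "'a::order set"
  assumes "finite A"
  shows "1 \<le> distinguishing_number A \<and>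
    (\<exists>c. c ` A \<subseteq> {1..distinguishing_number A} \<and> distinguishing_coloring A c)"
proof -
  obtain h where h: "bij_betw h A {0..<card A}"
    using ex_bij_betw_finite_nat[OF assms] by blast
  define c where "c = Suc \<circ> h"
  have inj: "inj_on c A"
    using h by (auto simp: c_def bij_betw_def intro: comp_inj_on)
  have "c ` A \<subseteq> {1..Suc (card A)}"
    using bij_betwE[OF h] by (auto simp: c_def less_imp_le)
  moreover have "distinguishing_coloring A c"
    using inj by (auto simp: distinguishing_coloring_def poset_automorphism_def
        dest: bij_betwE inj_onD)
  ultimately have "1 \<le> Suc (card A) \<and>
      (\<exists>c. c ` A \<subseteq> {1..Suc (card A)} \<and> distinguishing_coloring A c)"
    by auto
  then show ?thesis
    unfolding distinguishing_number_def by (rule LeastI)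
qed

definition covered_by :: "'a::order \<Rightarrow> 'a \<Rightarrow> bool" where
  "covered_by y x \<longleftrightarrow> y < x \<and> \<not> (\<exists>z. y < z \<and> z < x)"

text \<open>Exactly one downward edge in the Hasse diagram; in particular the bottom element is excluded.\<close>

definition join_irreducible :: "'a::lattice \<Rightarrow> bool" where
  "join_irreducible x \<longleftrightarrow> (\<exists>!y. covered_by y x)"

definition join_irreducibles :: "'a::lattice set" where
  "join_irreducibles = {x. join_irreducible x}"

end

theory Submission imports Defs begin

text \<open>
  Distinguishing number 1 means having no nontrivial automorphism. An automorphism of \<open>L\<close>
  preserves covers, so it restricts to \<open>Q\<^sub>L\<close>, and it is determined by that restriction because
  join-irreducibles are join-dense. Conversely, by distributivity join-irreducibles are
  join-prime, so every down-set of \<open>Q\<^sub>L\<close> is the set of join-irreducibles below some element of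
  \<open>L\<close> (Birkhoff), and hence every automorphism of \<open>Q\<^sub>L\<close> extends to \<open>L\<close>.
\<close>

section \<open>Rigidity and distinguishing number 1\<close>

lemma distinguishing_number_eq_1_iff:
  fixes A :: "'a::order set"
  assumes "finite A"
  shows "distinguishing_number A = 1 \<longleftrightarrow>
    (\<forall>f. poset_automorphism A f \<longrightarrow> (\<forall>x\<in>A. f x = x))"
proof
  assume "distinguishing_number A = 1"
  then obtain c :: "'a \<Rightarrow> nat" where c: "c ` A \<subseteq> {1..1}" "distinguishing_coloring A c"
    using distinguishing_number_witness[OF assms] by auto
  show "\<forall>f. poset_automorphism A f \<longrightarrow> (\<forall>x\<in>A. f x = x)"
  proof (intro allI impI)
    fix f assume f: "poset_automorphism A f"
    then have "f x \<in> A" if "x \<in> A" for x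
      using that by (auto simp: poset_automorphism_def dest: bij_betwE)
    \<comment> \<open>With the one-point palette \<open>{1..1}\<close>, \<open>c\<close> is constant
      on \<open>A\<close>, so every automorphism preserves it.\<close>
    then have "\<forall>x\<in>A. c (f x) = c x"
      using c(1) by (metis atLeastAtMost_singleton image_subset_iff singletonD)
    with f c(2) show "\<forall>x\<in>A. f x = x"
      unfolding distinguishing_coloring_def by blast
  qed
next
  assume "\<forall>f. poset_automorphism A f \<longrightarrow> (\<forall>x\<in>A. f x = x)"
  then have "\<exists>c. c ` A \<subseteq> {1..1::nat} \<and> distinguishing_coloring A c"
    by (intro exI[of _ "\<lambda>_. 1"]) (auto simp: distinguishing_coloring_def)
  then show "distinguishing_number A = 1"
    unfolding distinguishing_number_def by (intro Least_equality) auto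
qed

section \<open>Lower covers, join-primeness and join-density\<close>

lemma ex_covered_by_above:
  fixes x y :: "'a::{finite, order}"
  assumes "y < x"
  obtains z where "y \<le> z" "covered_by z x"
proof -
  obtain z where z: "z \<in> {z. z < x}" "y \<le> z" "\<And>w. w \<in> {z. z < x} \<Longrightarrow> z \<le> w \<Longrightarrow> z = w"
    using finite_has_maximal2[of "{z. z < x}" y] assms by auto
  then have "covered_by z x"
    unfolding covered_by_def by force
  with z(2) that show ?thesis by blast
qed

text \<open>In a finite lattice the unique lower cover \<open>c\<close> of \<open>j\<close> bounds
  everything strictly below \<open>j\<close>. If \<open>j\<close> were below neither
  \<open>a\<close> nor \<open>b\<close>, both \<open>inf j a\<close> and \<open>inf j b\<close>
  would be at most \<open>c\<close>; by distributivity their join is \<open>j\<close>, a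
  contradiction.\<close>

lemma join_irreducible_le_sup_iff:
  fixes j a b :: "'a::{finite, distrib_lattice}"
  assumes "join_irreducible j"
  shows "j \<le> sup a b \<longleftrightarrow> j \<le> a \<or> j \<le> b"
proof
  assume le: "j \<le> sup a b"
  obtain c where c: "covered_by c j" "\<And>d. covered_by d j \<Longrightarrow> d = c"
    using assms unfolding join_irreducible_def by blast
  have below: "w \<le> c" if "w < j" for w
    using ex_covered_by_above[OF that] c(2) by metis
  show "j \<le> a \<or> j \<le> b"
  proof (rule ccontr)
    assume "\<not> (j \<le> a \<or> j \<le> b)"
    then have "inf j a < j" "inf j b < j"
      by (auto simp: less_le_not_le)
    then have "sup (inf j a) (inf j b) \<le> c"
      using below by simp
    moreover have "sup (inf j a) (inf j b) = j"
      using le by (simp add: inf_sup_distrib1[symmetric] inf.absorb1)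
    ultimately show False
      using c(1) by (auto simp: covered_by_def)
  qed
qed (auto intro: le_supI1 le_supI2)

text \<open>Take \<open>j\<close> below \<open>x\<close> and minimal among the elements not below
  \<open>y\<close>. Everything strictly below \<open>j\<close> is then below \<open>y\<close>, so
  \<open>j\<close> cannot be the join of two smaller elements, as it would be if it had two lower
  covers.\<close>

lemma ex_join_irreducible_separating:
  fixes x y :: "'a::{finite, lattice}"
  assumes "\<not> x \<le> y"
  obtains j where "join_irreducible j" "j \<le> x" "\<not> j \<le> y"
proof -
  obtain j where j: "\<not> j \<le> y" "j \<le> x"
    and min: "\<And>w. w \<in> {z. \<not> z \<le> y} \<Longrightarrow> w \<le> j \<Longrightarrow> j = w"
    using finite_has_minimal2[of "{z. \<not> z \<le> y}" x] assms by auto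
  have below: "w \<le> y" if "w < j" for w
    using min[of w] that by (auto simp: less_le)
  \<comment> \<open>This supplies an element strictly below \<open>j\<close>, hence at least one
    lower cover.\<close>
  have "inf j y < j"
    using j(1) by (auto simp: less_le_not_le)
  then obtain c where c: "covered_by c j"
    by (rule ex_covered_by_above)
  have "d = c" if d: "covered_by d j" for d
  proof (rule ccontr)
    assume "d \<noteq> c"
    have lt: "c < j" "d < j"
      using c d by (auto simp: covered_by_def)
    \<comment> \<open>Distinct lower covers are incomparable, so their join exceeds \<open>c\<close>
      and can only be \<open>j\<close>.\<close>
    have "c < sup c d"
    proof -
      have "\<not> d \<le> c"
        using c d \<open>d \<noteq> c\<close> lt by (auto simp: covered_by_def less_le)
      then show ?thesis
        by (auto simp: less_le_not_le)
    qed
    moreover have "sup c d \<le> j"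
      using lt by auto
    ultimately have "sup c d = j"
      using c unfolding covered_by_def by (metis order_le_imp_less_or_eq)
    moreover have "sup c d \<le> y"
      using below lt by simp
    ultimately show False
      using j(1) by simp
  qed
  with c have "join_irreducible j"
    unfolding join_irreducible_def by blast
  with j that show ?thesis by blast
qed

section \<open>Birkhoff representation by down-sets of join-irreducibles\<close>

definition irreducibles_below :: "'a::lattice \<Rightarrow> 'a set" where
  "irreducibles_below x = {j \<in> join_irreducibles. j \<le> x}"

lemma irreducibles_below_subset_iff:
  fixes x y :: "'a::{finite, lattice}"
  shows "irreducibles_below x \<subseteq> irreducibles_below y \<longleftrightarrow> x \<le> y"
proof
  assume sub: "irreducibles_below x \<subseteq> irreducibles_below y"
  show "x \<le> y"
  proof (rule ccontr)
    assume "\<not> x \<le> y"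
    then obtain j where "join_irreducible j" "j \<le> x" "\<not> j \<le> y"
      by (rule ex_join_irreducible_separating)
    with sub show False
      by (auto simp: irreducibles_below_def join_irreducibles_def)
  qed
qed (auto simp: irreducibles_below_def)

lemma irreducibles_below_inject:
  fixes x y :: "'a::{finite, lattice}"
  shows "irreducibles_below x = irreducibles_below y \<longleftrightarrow> x = y"
  by (metis irreducibles_below_subset_iff order_antisym order_refl)

text \<open>The join of \<open>T\<close> is the required element: since join-irreducibles are
  join-prime, \<open>irreducibles_below\<close> turns binary joins into unions.\<close>

lemma ex_irreducibles_below_eq_Union:
  fixes T :: "'a::{finite, distrib_lattice} set"
  assumes "finite T"
  shows "\<exists>x. irreducibles_below x = (\<Union>j\<in>T. irreducibles_below j)"
  using assms
proof (induction T rule: finite_induct)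
  case empty
  \<comment> \<open>\<open>Inf_fin UNIV\<close> is the least element of the lattice, the value of
    the empty join. No join-irreducible lies below it, because each has something strictly below
    itself.\<close>
  have "irreducibles_below (Inf_fin (UNIV :: 'a set)) = {}"
  proof -
    have "\<not> j \<le> Inf_fin UNIV" if j: "join_irreducible j" for j :: 'a
    proof -
      obtain c where "c < j"
        using j by (auto simp: join_irreducible_def covered_by_def)
      moreover have "Inf_fin UNIV \<le> c"
        by (rule Inf_fin.coboundedI) auto
      ultimately show ?thesis by auto
    qed
    then show ?thesis
      by (auto simp: irreducibles_below_def join_irreducibles_def)
  qed
  then show ?case by auto
next
  case (insert j T)
  then obtain x where x: "irreducibles_below x = (\<Union>j\<in>T. irreducibles_below j)" by blast
  have "irreducibles_below (sup j x) = irreducibles_below j \<union> irreducibles_below x"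
    by (auto simp: irreducibles_below_def join_irreducibles_def join_irreducible_le_sup_iff)
  with x show ?case by auto
qed

text \<open>A down-set is the union of the principal down-sets of its members.\<close>

lemma ex_irreducibles_below_eq:
  fixes S :: "'a::{finite, distrib_lattice} set"
  assumes "S \<subseteq> join_irreducibles"
    and "\<And>i j. j \<in> S \<Longrightarrow> i \<in> join_irreducibles \<Longrightarrow> i \<le> j \<Longrightarrow> i \<in> S"
  shows "\<exists>x. irreducibles_below x = S"
proof -
  have "(\<Union>j\<in>S. irreducibles_below j) = S"
    using assms by (auto simp: irreducibles_below_def)
  then show ?thesis
    using ex_irreducibles_below_eq_Union[of S] by simp
qed

section \<open>Restricting lattice automorphisms to the join-irreducibles\<close>

lemma poset_automorphism_covered_by_iff:
  assumes "poset_automorphism UNIV f"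
  shows "covered_by (f y) (f x) \<longleftrightarrow> covered_by y x"
proof -
  have le: "f a \<le> f b \<longleftrightarrow> a \<le> b" for a b
    using assms by (simp add: poset_automorphism_def)
  have lt: "f a < f b \<longleftrightarrow> a < b" for a b
    using le by (simp add: less_le_not_le)
  have "surj f"
    using assms by (simp add: poset_automorphism_def bij_betw_def)
  then have "(\<exists>z. f y < z \<and> z < f x) \<longleftrightarrow> (\<exists>z. f y < f z \<and> f z < f x)"
    by (metis surjD)
  then show ?thesis
    by (simp add: covered_by_def lt)
qed

lemma poset_automorphism_join_irreducible_iff:
  assumes "poset_automorphism UNIV f"
  shows "join_irreducible (f x) \<longleftrightarrow> join_irreducible x"
proof -
  have "bij f"
    using assms by (simp add: poset_automorphism_def)
  \<comment> \<open>Surjectivity lets every candidate cover be written as \<open>f y\<close>;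
    injectivity carries uniqueness across.\<close>
  then have "(\<exists>!y. covered_by y (f x)) \<longleftrightarrow> (\<exists>!y. covered_by (f y) (f x))"
    by (metis bij_is_surj bij_is_inj injD surjD)
  then show ?thesis
    by (simp add: join_irreducible_def poset_automorphism_covered_by_iff[OF assms])
qed

lemma poset_automorphism_restrict_join_irreducibles:
  fixes f :: "'a::lattice \<Rightarrow> 'a"
  assumes "poset_automorphism UNIV f"
  shows "poset_automorphism join_irreducibles f"
proof -
  have bij: "bij f"
    using assms by (simp add: poset_automorphism_def)
  have "f ` join_irreducibles = join_irreducibles"
  proof (intro subset_antisym subsetI)
    fix x :: 'a assume x: "x \<in> join_irreducibles"
    obtain w where "x = f w"
      using bij by (metis bij_pointE)
    with x show "x \<in> f ` join_irreducibles"
      using poset_automorphism_join_irreducible_iff[OF assms]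
      by (auto simp: join_irreducibles_def)
  qed (auto simp: join_irreducibles_def poset_automorphism_join_irreducible_iff[OF assms])
  then have "bij_betw f join_irreducibles join_irreducibles"
    using bij by (auto simp: bij_betw_def intro: inj_on_subset)
  with assms show ?thesis
    by (simp add: poset_automorphism_def)
qed

text \<open>For a fixed join-irreducible \<open>j\<close>, \<open>j \<le> f x\<close> reads
  \<open>f j \<le> f x\<close>, that is \<open>j \<le> x\<close>. So \<open>x\<close> and
  \<open>f x\<close> have the same join-irreducibles below them.\<close>

lemma poset_automorphism_eq_id_if_fixes_join_irreducibles:
  fixes f :: "'a::{finite, lattice} \<Rightarrow> 'a"
  assumes f: "poset_automorphism UNIV f" and fixed: "\<forall>j\<in>join_irreducibles. f j = j"
  shows "f x = x"
proof -
  have "j \<le> f x \<longleftrightarrow> j \<le> x" if "j \<in> join_irreducibles" for j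
    using f fixed that by (metis UNIV_I poset_automorphism_def)
  then have "irreducibles_below (f x) = irreducibles_below x"
    by (auto simp: irreducibles_below_def)
  then show ?thesis
    by (simp add: irreducibles_below_inject)
qed

section \<open>Extending automorphisms of the join-irreducibles to the lattice\<close>

lemma poset_automorphism_image_irreducibles_below:
  assumes g: "poset_automorphism join_irreducibles g" and i: "i \<in> join_irreducibles"
    and j: "j \<in> g ` irreducibles_below x" and le: "i \<le> j"
  shows "i \<in> g ` irreducibles_below x"
proof -
  obtain j' where j': "j = g j'" "j' \<in> join_irreducibles" "j' \<le> x"
    using j by (auto simp: irreducibles_below_def)
  obtain i' where i': "i = g i'" "i' \<in> join_irreducibles"
    using g i by (metis poset_automorphism_def bij_betw_imp_surj_on imageE)
  have "i' \<le> j'"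
    using g le i' j' by (auto simp: poset_automorphism_def)
  with i' j'(3) show ?thesis
    by (auto simp: irreducibles_below_def)
qed

text \<open>The extension \<open>f\<close> is \<open>g\<close> acting on down-sets, read back
  through the Birkhoff representation: the image under \<open>g\<close> of the down-set of
  \<open>x\<close> is again a down-set, and \<open>f x\<close> is the element representing
  it.\<close>

lemma poset_automorphism_join_irreducibles_extends:
  fixes g :: "'a::{finite, distrib_lattice} \<Rightarrow> 'a"
  assumes g: "poset_automorphism join_irreducibles g"
  obtains f where "poset_automorphism UNIV f" "\<forall>j\<in>join_irreducibles. f j = g j"
proof -
  have inj: "inj_on g join_irreducibles" and img: "g ` join_irreducibles = join_irreducibles"
    and le: "\<And>i j. i \<in> join_irreducibles \<Longrightarrow> j \<in> join_irreducibles \<Longrightarrow> g i \<le> g j \<longleftrightarrow> i \<le> j"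
    using g by (auto simp: poset_automorphism_def bij_betw_def)
  have sub: "irreducibles_below x \<subseteq> join_irreducibles" for x :: 'a
    by (auto simp: irreducibles_below_def)
  have "\<exists>y. irreducibles_below y = g ` irreducibles_below x" for x
  proof (rule ex_irreducibles_below_eq)
    show "g ` irreducibles_below x \<subseteq> join_irreducibles"
      using sub img by blast
  qed (rule poset_automorphism_image_irreducibles_below[OF g])
  then obtain f where f: "\<And>x. irreducibles_below (f x) = g ` irreducibles_below x"
    by metis
  have f_le: "f x \<le> f y \<longleftrightarrow> x \<le> y" for x y
  proof -
    \<comment> \<open>Inclusion is rewritten as an equation between unions, where injectivity of
      \<open>g\<close> on the join-irreducibles applies.\<close>
    have "g ` irreducibles_below x \<subseteq> g ` irreducibles_below y \<longleftrightarrow>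
        irreducibles_below x \<subseteq> irreducibles_below y"
      using inj sub by (metis image_mono inj_on_image_eq_iff image_Un subset_Un_eq Un_subset_iff)
    then show ?thesis
      using irreducibles_below_subset_iff[of x y] irreducibles_below_subset_iff[of "f x" "f y"]
      by (simp only: f)
  qed
  then have "inj f"
    by (intro injI order_antisym) (metis order_refl)+
  \<comment> \<open>An injective self-map of a finite type is surjective.\<close>
  then have "bij f"
    by (simp add: bij_def finite_UNIV_inj_surj)
  with f_le have "poset_automorphism UNIV f"
    by (simp add: poset_automorphism_def)
  \<comment> \<open>\<open>g\<close> maps the principal down-set of \<open>j\<close> onto that of
    \<open>g j\<close>, so \<open>f j\<close> and \<open>g j\<close> represent the same
    down-set.\<close>
  moreover have "f j = g j" if j: "j \<in> join_irreducibles" for j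
  proof -
    have "g ` irreducibles_below j \<subseteq> irreducibles_below (g j)"
      using j img le by (auto simp: irreducibles_below_def)
    moreover have "irreducibles_below (g j) \<subseteq> g ` irreducibles_below j"
    proof
      fix i assume i: "i \<in> irreducibles_below (g j)"
      have "g j \<in> g ` irreducibles_below j"
        using j by (auto simp: irreducibles_below_def)
      with i show "i \<in> g ` irreducibles_below j"
        using poset_automorphism_image_irreducibles_below[OF g]
        by (auto simp: irreducibles_below_def[of "g j"])
    qed
    ultimately have "irreducibles_below (f j) = irreducibles_below (g j)"
      by (simp only: f subset_antisym)
    then show ?thesis
      by (simp only: irreducibles_below_inject)
  qed
  ultimately show ?thesis
    using that by blast
qed

theorem theorem3p7:
  "distinguishing_number (UNIV :: 'a::{finite, distrib_lattice} set) = 1 \<longleftrightarrow>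
   distinguishing_number (join_irreducibles :: 'a set) = 1"
proof -
  have "(\<forall>f. poset_automorphism (UNIV :: 'a set) f \<longrightarrow> (\<forall>x\<in>UNIV. f x = x)) \<longleftrightarrow>
    (\<forall>g. poset_automorphism (join_irreducibles :: 'a set) g \<longrightarrow> (\<forall>j\<in>join_irreducibles. g j = j))"
    (is "?L \<longleftrightarrow> ?R")
  proof
    assume ?L
    then show ?R
      by (metis UNIV_I poset_automorphism_join_irreducibles_extends)
  next
    assume ?R
    then show ?L
      using poset_automorphism_restrict_join_irreducibles
        poset_automorphism_eq_id_if_fixes_join_irreducibles by blast
  qed
  then show ?thesis
    by (simp only: distinguishing_number_eq_1_iff[OF finite])
qed

end
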